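(* Let $n\ge 2$ be an integer with $r$ distinct prime factors. Let $D=\mathrm{diag}(-1,0,0,\dots,0)$ be of order $2^r$ and $\tilde Q_n=Q_n-D$. Then for each $1\le j\le 2^r$, $$\lambda_j(\tilde Q_n)+\lambda_{2^r}(D)\le \lambda_j(Q_n)\le \lambda_j(\tilde Q_n)+\lambda_1(D).$$
   Context: For a real symmetric $m\times m$ matrix $X$, $\lambda_1(X)\ge\lambda_2(X)\ge\dots\ge\lambda_m(X)$ denote its eigenvalues in decreasing order, with multiplicity. Let $p_1<\dots<p_r$ be the distinct primes dividing $n$ and $n_0=p_1\cdots p_r$. The divisors of $n_0$ are ordered as $(d_1,\dots,d_{2^r})$ recursively: for $r=1$ the order is $(1,p_1)$, and for $r$ primes the first $2^{r-1}$ entries are those for the primes $p_1,\dots,p_{r-1}$, the remaining $2^{r-1}$ entries being obtained by multiplying each of these, in order, by $p_r$. For a divisor $d$ of $n_0$, $[d]=\{a\in\{0,1,\dots,n-1\}:\gcd(a,n_0)=d\}$ (with $\gcd(0,n_0)=n_0$), and $a_i=|[d_{i+1}]|$ for $1\le i\le 2^r-1$. $Q_n$ is the symmetric real $2^r\times 2^r$ matrix whose $(1,1)$ entry is $\varphi(n)-1$, whose other diagonal entries are $0$, and whose off-diagonal entries are $\rho_{i,j}$, where $\rho_{1,j}=\rho_{j,1}=\sqrt{\varphi(n)a_{j-1}}$ for $j\ge2$, and for $i\neq j$ with $i,j\ge 2$, $\rho_{i,j}=\sqrt{a_{i-1}a_{j-1}}$ if $\gcd(d_i,d_j)=1$ and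 $\rho_{i,j}=0$ otherwise. $\varphi$ is Euler's totient function. *)

theory Defs
  imports "Jordan_Normal_Form.Char_Poly" "Jordan_Normal_Form.Conjugate"
    "HOL-Number_Theory.Totient"
begin

(* A real symmetric matrix of order m has exactly m real eigenvalues counted with multiplicity
   (length_eigenvalues_desc below), so the list below has length m and eigval X j is
   \<lambda>_j(X) for 1 \<le> j \<le> m. *)
definition eigenvalues_desc :: "real mat \<Rightarrow> real list" where
  "eigenvalues_desc X = rev (sorted_list_of_multiset (proots (char_poly X)))"

definition eigval :: "real mat \<Rightarrow> nat \<Rightarrow> real" where
  "eigval X j = eigenvalues_desc X ! (j - 1)"

lemma eigenvalue_hermitian_real:
  fixes A :: "complex mat"
  assumes A: "A \<in> carrier_mat n n"
    and herm: "\<And>i j. i < n \<Longrightarrow> j < n \<Longrightarrow> A $$ (i, j) = cnj (A $$ (j, i))"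
    and ev: "eigenvalue A k"
  shows "k \<in> \<real>"
proof -
  obtain v where v: "v \<in> carrier_vec n" "v \<noteq> 0\<^sub>v n" and Av: "A *\<^sub>v v = k \<cdot>\<^sub>v v"
    using ev A by (auto simp: eigenvalue_def eigenvector_def)
  have row: "(\<Sum>j<n. A $$ (i, j) * v $ j) = k * v $ i" if i: "i < n" for i
  proof -
    have "(A *\<^sub>v v) $ i = (k \<cdot>\<^sub>v v) $ i" using Av by simp
    thus ?thesis using i A v by (simp add: scalar_prod_def lessThan_atLeast0)
  qed
  define S where "S = (\<Sum>i<n. \<Sum>j<n. cnj (v $ i) * A $$ (i, j) * v $ j)"
  define N where "N = (\<Sum>i<n. (cmod (v $ i))\<^sup>2)"
  have "S = (\<Sum>i<n. cnj (v $ i) * (k * v $ i))"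
    unfolding S_def by (intro sum.cong refl) (simp add: row[symmetric] sum_distrib_left mult.assoc)
  also have "\<dots> = k * of_real N"
    unfolding N_def of_real_sum sum_distrib_left
    by (intro sum.cong refl) (simp add: complex_norm_square mult_ac del: of_real_power)
  finally have SN: "S = k * of_real N" .
  have "cnj S = (\<Sum>i<n. \<Sum>j<n. v $ i * A $$ (j, i) * cnj (v $ j))"
    unfolding S_def cnj_sum complex_cnj_mult complex_cnj_cnj
    by (intro sum.cong refl) (simp add: herm[symmetric])
  also have "\<dots> = S"
    unfolding S_def by (subst sum.swap) (simp add: mult_ac)
  finally have "cnj S = S" .
  have "N \<noteq> 0"
  proof
    assume "N = 0"
    hence "\<forall>i<n. v $ i = 0" unfolding N_def by (subst (asm) sum_nonneg_eq_0_iff) auto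
    with v show False by auto
  qed
  from \<open>cnj S = S\<close> SN have "cnj k * of_real N = k * of_real N" by simp
  with \<open>N \<noteq> 0\<close> have "cnj k = k" by simp
  thus ?thesis by (simp add: Reals_cnj_iff)
qed

lemma length_eigenvalues_desc:
  fixes X :: "real mat"
  assumes X: "X \<in> carrier_mat m m"
    and sym: "\<And>i j. i < m \<Longrightarrow> j < m \<Longrightarrow> X $$ (i, j) = X $$ (j, i)"
  shows "length (eigenvalues_desc X) = m"
proof -
  let ?A = "map_mat complex_of_real X"
  have A: "?A \<in> carrier_mat m m" using X by simp
  from char_poly_factorized[OF A] obtain as where
    as: "char_poly ?A = (\<Prod>a\<leftarrow>as. [:- a, 1:])" and len: "length as = m" by blast
  have "a \<in> \<real>" if a: "a \<in> set as" for a
  proof (rule eigenvalue_hermitian_real[OF A])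
    show "eigenvalue ?A a"
      unfolding eigenvalue_root_char_poly[OF A] as
      using a by (auto simp: poly_prod_list prod_list_zero_iff)
  qed (use X in \<open>simp, metis sym\<close>)
  hence "\<exists>bs. as = map complex_of_real bs"
    by (intro exI[of _ "map Re as"]) (simp add: map_idI)
  then obtain bs where bs: "as = map complex_of_real bs" ..
  interpret of_real_poly: map_poly_inj_idom_hom complex_of_real ..
  have "map_poly complex_of_real (char_poly X) = char_poly ?A"
    by (rule of_real_hom.char_poly_hom[OF X, symmetric])
  also have "\<dots> = map_poly complex_of_real (\<Prod>b\<leftarrow>bs. [:- b, 1:])"
    unfolding as bs
    by (induction bs)
      (simp_all add: of_real_poly.hom_mult del: mult_pCons_left)
  finally have cp: "char_poly X = (\<Prod>b\<leftarrow>bs. [:- b, 1:])"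
    by simp
  have "proots (\<Prod>b\<leftarrow>bs. [:- b, 1:]) = mset bs"
  proof (induction bs)
    case (Cons b bs)
    have "(\<Prod>b\<leftarrow>bs. [:- b, 1:]) \<noteq> 0" by (auto simp: prod_list_zero_iff)
    with Cons.IH show ?case by (simp add: proots_mult del: mult_pCons_left)
  qed simp
  thus ?thesis using len unfolding eigenvalues_desc_def cp bs
    by (simp add: bs flip: size_mset)
qed

definition radical :: "nat \<Rightarrow> nat" where
  "radical n = \<Prod>(prime_factors n)"

definition ordered_divisors :: "nat \<Rightarrow> nat list" where
  "ordered_divisors n =
     foldl (\<lambda>ds p. ds @ map (\<lambda>d. d * p) ds) [1] (sorted_list_of_set (prime_factors n))"

definition dv :: "nat \<Rightarrow> nat \<Rightarrow> nat" where
  "dv n i = ordered_divisors n ! (i - 1)"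

definition gcd_class :: "nat \<Rightarrow> nat \<Rightarrow> nat set" where
  "gcd_class n d = {a \<in> {0..<n}. gcd a (radical n) = d}"

definition class_card :: "nat \<Rightarrow> nat \<Rightarrow> nat" where
  "class_card n i = card (gcd_class n (dv n (i + 1)))"

(* Only used for i \<noteq> j; indices start at 1. *)
definition rho :: "nat \<Rightarrow> nat \<Rightarrow> nat \<Rightarrow> real" where
  "rho n i j =
     (if i = 1 then sqrt (real (totient n) * real (class_card n (j - 1)))
      else if j = 1 then sqrt (real (totient n) * real (class_card n (i - 1)))
      else if gcd (dv n i) (dv n j) = 1
        then sqrt (real (class_card n (i - 1)) * real (class_card n (j - 1)))
      else 0)"

(* Matrices are indexed from 0, hence the shift in the arguments of rho. *)
definition Q_mat :: "nat \<Rightarrow> real mat" where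
  "Q_mat n = mat (2 ^ card (prime_factors n)) (2 ^ card (prime_factors n))
     (\<lambda>(i, j). if i = j then (if i = 0 then real (totient n) - 1 else 0)
              else rho n (i + 1) (j + 1))"

definition D_mat :: "nat \<Rightarrow> real mat" where
  "D_mat r = mat_diag (2 ^ r) (\<lambda>i. if i = 0 then - 1 else 0)"

end

theory Submission
  imports Defs "Jordan_Normal_Form.Schur_Decomposition"
begin

text \<open>A real symmetric matrix has an orthonormal eigenbasis \<open>u\<^sub>1, \<dots>, u\<^sub>m\<close>, listed in the order of
  its decreasing eigenvalues. For symmetric \<open>A\<close> and \<open>B\<close> with eigenbases \<open>u\<close> and \<open>w\<close>, the \<open>m - 1\<close>
  linear conditions \<open>x \<bottom> u\<^sub>i\<close> for \<open>i > j\<close> and \<open>x \<bottom> w\<^sub>i\<close> for \<open>i < j\<close> have a common solution \<open>x \<noteq> 0\<close>, for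
  which \<open>\<lambda>\<^sub>j(A) |x|\<^sup>2 \<le> x \<bullet> A x\<close> and \<open>x \<bullet> B x \<le> \<lambda>\<^sub>j(B) |x|\<^sup>2\<close>. Hence an inequality between the
  quadratic forms carries over to the \<open>j\<close>-th eigenvalues, and Weyl's inequalities follow since
  \<open>\<lambda>\<^sub>m(D) |x|\<^sup>2 \<le> x \<bullet> D x \<le> \<lambda>\<^sub>1(D) |x|\<^sup>2\<close>.\<close>

section \<open>Splitting of the characteristic polynomial over the reals\<close>

text \<open>Splitting off one linear factor lowers both the degree and the size of
  \<open>proots\<close> by exactly one, so the hypothesis that they agree passes to the
  quotient.\<close>

lemma monic_eq_prod_proots:
  fixes p :: "'a :: idom poly"
  assumes "monic p" "size (proots p) = degree p"
  shows "p = (\<Prod>x\<in>#proots p. [:- x, 1:])"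
  using assms
proof (induction "degree p" arbitrary: p)
  case 0
  then have "p = 1" by (simp add: monic_degree_0)
  then show ?case by simp
next
  case (Suc d)
  then have "proots p \<noteq> {#}" by (metis size_empty nat.distinct(1))
  then obtain x where "x \<in># proots p" by blast
  moreover have p0: "p \<noteq> 0" using Suc.prems(1) by auto
  ultimately have "poly p x = 0" by simp
  then obtain q where p: "p = [:- x, 1:] * q"
    unfolding poly_eq_0_iff_dvd by (elim dvdE)
  have q0: "q \<noteq> 0" using p0 p by auto
  have pr: "proots p = add_mset x (proots q)"
    unfolding p using q0 by (subst proots_mult) auto
  have deg: "degree p = Suc (degree q)"
    unfolding p using q0 by (subst degree_mult_eq) auto
  have "monic q" using Suc.prems(1) unfolding p by (simp only: lead_coeff_mult) simp
  then have "q = (\<Prod>x\<in>#proots q. [:- x, 1:])"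
    using Suc.hyps Suc.prems(2) deg pr by simp
  then show ?case unfolding pr by (metis p image_mset_add_mset prod_mset.add_mset)
qed

text \<open>\<open>length_eigenvalues_desc\<close> says that as many real roots exist as the degree
  allows, so \<open>monic_eq_prod_proots\<close> applies.\<close>

lemma char_poly_eq_prod_eigenvalues_desc:
  assumes X: "X \<in> carrier_mat m m" and sym: "X\<^sup>T = X"
  shows "char_poly X = (\<Prod>a\<leftarrow>eigenvalues_desc X. [:- a, 1:])"
    and "length (eigenvalues_desc X) = m"
    and "sorted_wrt (\<ge>) (eigenvalues_desc X)"
proof -
  have sym': "X $$ (i, j) = X $$ (j, i)" if "i < m" "j < m" for i j
    using X that index_transpose_mat(1)[of i X j] sym by auto
  show len: "length (eigenvalues_desc X) = m"
    using X sym' by (rule length_eigenvalues_desc)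
  have ms: "mset (eigenvalues_desc X) = proots (char_poly X)"
    by (simp add: eigenvalues_desc_def)
  have deg: "degree (char_poly X) = m" "monic (char_poly X)"
    using degree_monic_char_poly[OF X] by auto
  have "char_poly X = (\<Prod>x\<in>#mset (eigenvalues_desc X). [:- x, 1:])"
    unfolding ms using deg len by (intro monic_eq_prod_proots) (auto simp flip: ms)
  then show "char_poly X = (\<Prod>a\<leftarrow>eigenvalues_desc X. [:- a, 1:])"
    by (metis mset_map prod_mset_prod_list)
  show "sorted_wrt (\<ge>) (eigenvalues_desc X)"
    unfolding eigenvalues_desc_def sorted_wrt_rev by simp
qed

section \<open>Orthogonal diagonalization of real symmetric matrices\<close>

text \<open>Complete \<open>v\<close> to a basis, orthogonalize by Gram-Schmidt and normalize; the
  first vector changes only by the scalar \<open>c\<close>.\<close>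

lemma orthogonal_matrix_with_first_column:
  fixes v :: "real vec"
  assumes v: "v \<in> carrier_vec n" "v \<noteq> 0\<^sub>v n"
  obtains U c where "U \<in> carrier_mat n n" "U\<^sup>T * U = 1\<^sub>m n" "col U 0 = c \<cdot>\<^sub>v v"
proof -
  interpret cof_vec_space n "TYPE(real)" .
  define b where "b = basis_completion v"
  define ws where "ws = gram_schmidt n b"
  note bc = basis_completion[OF v, folded b_def]
  note gs = gram_schmidt_result[OF bc(2,4,5) ws_def]
  have n: "n \<noteq> 0" using v by (metis carrier_vecD eq_vecI index_zero_vec(2) less_nat_zero_code)
  obtain vs where "b = v # vs" using bc(6,7) n by (cases b) auto
  then have "hd ws = v" unfolding ws_def using v by simp
  then have w0: "ws ! 0 = v"
    using gs(4) bc(6) n by (metis hd_conv_nth length_0_conv)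
  have len: "length ws = n" using gs(4) bc(6) by simp
  have wc: "ws ! i \<in> carrier_vec n" if "i < n" for i
    using gs(3) len that by (metis nth_mem subset_iff)
  define us where "us = map (\<lambda>w. (1 / sqrt (w \<bullet> w)) \<cdot>\<^sub>v w) ws"
  define U where "U = mat_of_cols n us"
  have U: "U \<in> carrier_mat n n"
    unfolding U_def us_def len[symmetric] by (metis length_map mat_of_cols_carrier(1))
  have colU: "col U i = (1 / sqrt (ws ! i \<bullet> ws ! i)) \<cdot>\<^sub>v ws ! i" if "i < n" for i
    using that len wc[OF that] by (simp add: U_def us_def)
  have "U\<^sup>T * U = 1\<^sub>m n"
  proof (rule eq_matI)
    fix i j assume "i < dim_row (1\<^sub>m n :: real mat)" "j < dim_col (1\<^sub>m n :: real mat)"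
    then have ij: "i < n" "j < n" by auto
    \<comment> \<open>For \<open>i = j\<close> this says that no vector of \<open>ws\<close> has
      norm zero, so the divisions in \<open>us\<close> are genuine.\<close>
    have orth: "(ws ! i \<bullet> ws ! j = 0) = (i \<noteq> j)"
      using corthogonalD[OF gs(2), of i j] ij len by simp
    have nonneg: "0 \<le> ws ! i \<bullet> ws ! i"
      unfolding scalar_prod_def by (intro sum_nonneg) auto
    have "(U\<^sup>T * U) $$ (i, j) = col U i \<bullet> col U j" using ij U by simp
    also have "\<dots> = ws ! i \<bullet> ws ! j / (sqrt (ws ! i \<bullet> ws ! i) * sqrt (ws ! j \<bullet> ws ! j))"
      using wc[OF ij(1)] wc[OF ij(2)] ij
      by (simp add: colU smult_scalar_prod_distrib[of _ n] scalar_prod_smult_distrib[of _ n])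
    also have "\<dots> = 1\<^sub>m n $$ (i, j)" using orth ij nonneg by (auto simp: real_sqrt_mult_self)
    finally show "(U\<^sup>T * U) $$ (i, j) = 1\<^sub>m n $$ (i, j)" .
  qed (use U in auto)
  with U that colU[of 0] n w0 show thesis by blast
qed

text \<open>Deflation: in an orthonormal basis starting with an eigenvector for \<open>e\<close>,
  symmetry makes the matrix split into \<open>e\<close> and a smaller symmetric block. The order of
  \<open>es\<close> is arbitrary, so the diagonal can later be taken decreasing.\<close>

theorem orthogonal_diagonalization:
  fixes A :: "real mat"
  assumes "A \<in> carrier_mat n n" "A\<^sup>T = A"
    and "char_poly A = (\<Prod>e\<leftarrow>es. [:- e, 1:])"
  shows "\<exists>U \<in> carrier_mat n n. U\<^sup>T * U = 1\<^sub>m n \<and> U\<^sup>T * A * U = mat_diag n (\<lambda>i. es ! i)"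
  using assms
proof (induction es arbitrary: n A)
  case Nil
  then have "n = 0" using degree_monic_char_poly[of A n] by auto
  with Nil show ?case by (intro bexI[of _ "1\<^sub>m 0"]) (auto simp: mat_diag_def)
next
  case (Cons e es)
  note A = Cons.prems(1) and sym = Cons.prems(2) and cp = Cons.prems(3)
  \<comment> \<open>Comparing degrees shows that there is a first row and column to split
    off.\<close>
  have "degree (char_poly A) = n" using degree_monic_char_poly[OF A] by auto
  moreover have "degree (char_poly A) = Suc (length es)"
    unfolding cp using degree_linear_factors[of uminus "e # es"] by simp
  ultimately obtain m where n: "n = Suc m" by auto
  then have n0: "0 < n" by simp
  have "eigenvalue A e" unfolding eigenvalue_root_char_poly[OF A] cp by simp
  then obtain v where v: "v \<in> carrier_vec n" "v \<noteq> 0\<^sub>v n" "A *\<^sub>v v = e \<cdot>\<^sub>v v"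
    unfolding eigenvalue_def eigenvector_def using A by auto
  obtain U c where U: "U \<in> carrier_mat n n" "U\<^sup>T * U = 1\<^sub>m n" "col U 0 = c \<cdot>\<^sub>v v"
    using orthogonal_matrix_with_first_column[OF v(1,2)] .
  have Ut: "U\<^sup>T \<in> carrier_mat n n" using U by simp
  have UUt: "U * U\<^sup>T = 1\<^sub>m n" using mat_mult_left_right_inverse[OF Ut U(1,2)] .
  define A' where "A' = U\<^sup>T * A * U"
  have A': "A' \<in> carrier_mat n n" using A U by (simp add: A'_def)
  have symA': "A'\<^sup>T = A'"
    unfolding A'_def using A U Ut sym
    by (simp add: transpose_mult[of _ n n _ n] assoc_mult_mat[of _ n n _ n _ n])
  have "similar_mat_wit A' A U\<^sup>T U"
    using A A' U Ut UUt by (intro similar_mat_witI[of _ _ n]) (auto simp: A'_def)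
  then have cpA': "char_poly A' = char_poly A"
    by (intro char_poly_similar) (auto simp: similar_mat_def)
  \<comment> \<open>The first column of \<open>U\<close> is an eigenvector which
    \<open>U\<^sup>T\<close> sends to the first unit vector; this determines the first column of
    \<open>A'\<close>.\<close>
  have "A *\<^sub>v col U 0 = e \<cdot>\<^sub>v col U 0"
    using A v by (simp add: U(3) mult_mat_vec[of _ n n] smult_smult_assoc mult.commute)
  moreover have "col A' 0 = U\<^sup>T *\<^sub>v (A *\<^sub>v col U 0)"
    unfolding A'_def assoc_mult_mat[OF Ut A U(1)] col_mult2[OF Ut mult_carrier_mat[OF A U(1)] n0]
      col_mult2[OF A U(1) n0] ..
  moreover have "U\<^sup>T *\<^sub>v (e \<cdot>\<^sub>v col U 0) = e \<cdot>\<^sub>v col (U\<^sup>T * U) 0"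
    unfolding col_mult2[OF Ut U(1) n0] using Ut U(1) by (intro mult_mat_vec) auto
  ultimately have "col A' 0 = e \<cdot>\<^sub>v col (U\<^sup>T * U) 0" by simp
  then have col0: "col A' 0 = e \<cdot>\<^sub>v unit_vec n 0" using U n by simp
  have col0': "A' $$ (i, 0) = (if i = 0 then e else 0)" if "i < n" for i
    using arg_cong[OF col0, of "\<lambda>x. x $ i"] A' that n by auto
  \<comment> \<open>Symmetry of \<open>A'\<close> carries the zeros of the first column over to the
    first row.\<close>
  have row0': "A' $$ (0, i) = (if i = 0 then e else 0)" if "i < n" for i
    using col0'[OF that] A' that n index_transpose_mat(1)[of 0 A' i] by (simp add: symA')
  define A3 where "A3 = mat m m (\<lambda>(i, j). A' $$ (Suc i, Suc j))"
  have A3: "A3 \<in> carrier_mat m m" by (simp add: A3_def)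
  have blk: "A' = four_block_mat (mat 1 1 (\<lambda>_. e)) (0\<^sub>m 1 m) (0\<^sub>m m 1) A3"
    using A' n by (intro eq_matI) (auto simp: A3_def col0' row0')
  have symA3: "A3\<^sup>T = A3"
  proof (rule eq_matI)
    fix i j assume "i < dim_row A3" "j < dim_col A3"
    then show "A3\<^sup>T $$ (i, j) = A3 $$ (i, j)"
      using A' n index_transpose_mat(1)[of "Suc i" A' "Suc j"] by (simp add: A3_def symA')
  qed (use A3 in auto)
  \<comment> \<open>Cancelling the common factor \<open>[:- e, 1:]\<close> leaves the factorization
    of \<open>char_poly A3\<close> over \<open>es\<close> that the induction hypothesis asks
    for.\<close>
  have "char_poly A' = char_poly (mat 1 1 (\<lambda>_. e)) * char_poly A3"
    unfolding blk by (rule char_poly_four_block_zeros_col[OF _ _ A3]) auto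
  also have "char_poly (mat 1 1 (\<lambda>_. e)) = [:- e, 1:]"
    by (simp add: char_poly_defs det_def sign_def)
  finally have "[:- e, 1:] * char_poly A3 = [:- e, 1:] * (\<Prod>e\<leftarrow>es. [:- e, 1:])"
    unfolding cpA' cp by simp
  then have "char_poly A3 = (\<Prod>e\<leftarrow>es. [:- e, 1:])"
    by (metis mult_cancel_left pCons_eq_0_iff zero_neq_one)
  from Cons.IH[OF A3 symA3 this] obtain V where
    V: "V \<in> carrier_mat m m" "V\<^sup>T * V = 1\<^sub>m m" "V\<^sup>T * A3 * V = mat_diag m (\<lambda>i. es ! i)"
    by auto
  \<comment> \<open>Bordering \<open>V\<close> with a 1 keeps the split-off entry \<open>e\<close>
    in place while the remaining block is diagonalized.\<close>
  define W where "W = four_block_mat (1\<^sub>m 1) (0\<^sub>m 1 m) (0\<^sub>m m 1) V"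
  have W: "W \<in> carrier_mat n n" using V(1) n by (auto simp: W_def)
  have Wt: "W\<^sup>T = four_block_mat (1\<^sub>m 1) (0\<^sub>m 1 m) (0\<^sub>m m 1) V\<^sup>T"
    unfolding W_def using V(1) by (subst transpose_four_block_mat[of _ 1 1 _ m _ m]) auto
  have WtW: "W\<^sup>T * W = 1\<^sub>m n"
    unfolding Wt unfolding W_def using V n
    by (subst mult_four_block_mat[of _ 1 1 _ m _ m _ _ 1 _ m]) auto
  have "W\<^sup>T * A' * W = four_block_mat (mat 1 1 (\<lambda>_. e)) (0\<^sub>m 1 m) (0\<^sub>m m 1) (V\<^sup>T * A3 * V)"
    unfolding Wt unfolding W_def blk using V(1) A3
    by (simp add: mult_four_block_mat[of _ 1 1 _ m _ m _ _ 1 _ m])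
  also have "\<dots> = mat_diag n (\<lambda>i. (e # es) ! i)"
    unfolding V(3) using n by (intro eq_matI) (auto simp: mat_diag_def nth_Cons')
  finally have WAW: "W\<^sup>T * A' * W = mat_diag n (\<lambda>i. (e # es) ! i)" .
  show ?case
  proof (intro bexI[of _ "U * W"] conjI)
    show "U * W \<in> carrier_mat n n" using U W by simp
    have t: "(U * W)\<^sup>T = W\<^sup>T * U\<^sup>T" using U W by (simp add: transpose_mult[of _ n n _ n])
    have "(U * W)\<^sup>T * (U * W) = W\<^sup>T * (U\<^sup>T * U) * W"
      unfolding t using U(1) W Ut by (simp add: assoc_mult_mat[of _ n n _ n _ n])
    also have "\<dots> = 1\<^sub>m n" using U(2) W WtW by simp
    finally show "(U * W)\<^sup>T * (U * W) = 1\<^sub>m n" .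
    have "(U * W)\<^sup>T * A * (U * W) = W\<^sup>T * A' * W"
      unfolding t A'_def using A U(1) W Ut by (simp add: assoc_mult_mat[of _ n n _ n _ n])
    then show "(U * W)\<^sup>T * A * (U * W) = mat_diag n (\<lambda>i. (e # es) ! i)"
      using WAW by simp
  qed
qed

section \<open>Quadratic forms in eigenvector coordinates\<close>

lemma mat_diag_mult_vec:
  fixes x :: "'a :: semiring_0 vec"
  assumes "x \<in> carrier_vec n"
  shows "mat_diag n f *\<^sub>v x = vec n (\<lambda>i. f i * x $ i)"
proof (rule eq_vecI)
  fix i assume "i < dim_vec (vec n (\<lambda>i. f i * x $ i))"
  then have i: "i < n" by simp
  have "(mat_diag n f *\<^sub>v x) $ i = (\<Sum>k<n. if i = k then f k * x $ k else 0)"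
    using i assms unfolding lessThan_atLeast0
    by (simp add: mat_diag_def scalar_prod_def if_distrib[of "\<lambda>a. a * _"] cong: if_cong)
  then show "(mat_diag n f *\<^sub>v x) $ i = vec n (\<lambda>i. f i * x $ i) $ i"
    using i by simp
qed (simp add: mat_diag_def)

text \<open>\<open>W\<close> is the transpose of the diagonalizing orthogonal matrix, so
  \<open>W *\<^sub>v x\<close> lists the coordinates of \<open>x\<close> in an orthonormal
  eigenbasis.\<close>

lemma quadratic_form_diagonalization:
  fixes A :: "real mat"
  assumes A: "A \<in> carrier_mat m m" "A\<^sup>T = A"
  obtains W where "W \<in> carrier_mat m m"
    and "\<And>x. x \<in> carrier_vec m \<Longrightarrow> x \<bullet> x = (\<Sum>i<m. ((W *\<^sub>v x) $ i)\<^sup>2)"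
    and "\<And>x. x \<in> carrier_vec m \<Longrightarrow>
      x \<bullet> (A *\<^sub>v x) = (\<Sum>i<m. eigval A (Suc i) * ((W *\<^sub>v x) $ i)\<^sup>2)"
proof -
  obtain U where U: "U \<in> carrier_mat m m" "U\<^sup>T * U = 1\<^sub>m m"
    and D: "U\<^sup>T * A * U = mat_diag m (\<lambda>i. eigenvalues_desc A ! i)"
    using orthogonal_diagonalization[OF A char_poly_eq_prod_eigenvalues_desc(1)[OF A]] by auto
  have Ut: "U\<^sup>T \<in> carrier_mat m m" using U by simp
  have UUt: "U * U\<^sup>T = 1\<^sub>m m" using mat_mult_left_right_inverse[OF Ut U(1,2)] .
  show thesis
  proof (rule that[OF Ut])
    fix x :: "real vec" assume x: "x \<in> carrier_vec m"
    define y where "y = U\<^sup>T *\<^sub>v x"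
    have y: "y \<in> carrier_vec m" using Ut x by (simp add: y_def)
    have inv: "U *\<^sub>v (U\<^sup>T *\<^sub>v z) = z" if "z \<in> carrier_vec m" for z
      using assoc_mult_mat_vec[OF U(1) Ut that] that by (simp add: UUt)
    have xy: "U *\<^sub>v y = x"
      unfolding y_def using x by (rule inv)
    \<comment> \<open>\<open>U\<close> and \<open>U\<^sup>T\<close> are adjoint, which moves a
      scalar product with \<open>x\<close> to the coordinates \<open>y\<close>.\<close>
    have move: "x \<bullet> (U *\<^sub>v z) = y \<bullet> z" if "z \<in> carrier_vec m" for z
      unfolding y_def using transpose_vec_mult_scalar[OF U(1) that x] by simp
    have "x \<bullet> x = y \<bullet> y" using move[OF y] by (simp add: xy)
    also have "\<dots> = (\<Sum>i<m. (y $ i)\<^sup>2)"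
      using y by (simp add: scalar_prod_def power2_eq_square lessThan_atLeast0)
    finally show "x \<bullet> x = (\<Sum>i<m. ((U\<^sup>T *\<^sub>v x) $ i)\<^sup>2)" by (simp add: y_def)
    have Ax: "A *\<^sub>v x \<in> carrier_vec m" using A x by simp
    have "x \<bullet> (A *\<^sub>v x) = x \<bullet> (U *\<^sub>v (U\<^sup>T *\<^sub>v (A *\<^sub>v x)))"
      by (simp only: inv[OF Ax])
    also have "\<dots> = y \<bullet> (U\<^sup>T *\<^sub>v (A *\<^sub>v (U *\<^sub>v y)))"
      unfolding xy using Ut Ax by (intro move) simp
    also have "U\<^sup>T *\<^sub>v (A *\<^sub>v (U *\<^sub>v y)) = (U\<^sup>T * A * U) *\<^sub>v y"
      using assoc_mult_mat_vec[OF mult_carrier_mat[OF Ut A(1)] U(1) y]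
        assoc_mult_mat_vec[OF Ut A(1) mult_mat_vec_carrier[OF U(1) y]] by (simp only:)
    also have "y \<bullet> \<dots> = (\<Sum>i<m. eigval A (Suc i) * (y $ i)\<^sup>2)"
      unfolding D scalar_prod_def
      using mat_diag_mult_vec[OF y, of "\<lambda>i. eigenvalues_desc A ! i"]
      by (simp add: eigval_def lessThan_atLeast0 power2_eq_square mult_ac)
    finally show "x \<bullet> (A *\<^sub>v x) = (\<Sum>i<m. eigval A (Suc i) * ((U\<^sup>T *\<^sub>v x) $ i)\<^sup>2)"
      by (simp add: y_def)
  qed
qed

lemma eigval_antimono:
  assumes "A \<in> carrier_mat m m" "A\<^sup>T = A" "1 \<le> i" "i \<le> j" "j \<le> m"
  shows "eigval A j \<le> eigval A i"
proof (cases "i = j")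
  case False
  with assms show ?thesis
    using char_poly_eq_prod_eigenvalues_desc(2,3)[OF assms(1,2)]
    by (auto simp: eigval_def sorted_wrt_iff_nth_less)
qed simp

text \<open>In eigenvector coordinates the form is a sum of squares whose weights lie between the
  smallest and the largest eigenvalue.\<close>

lemma quadratic_form_bounds:
  assumes A: "A \<in> carrier_mat m m" "A\<^sup>T = A" and x: "x \<in> carrier_vec m" and m: "1 \<le> m"
  shows "eigval A m * (x \<bullet> x) \<le> x \<bullet> (A *\<^sub>v x)"
    and "x \<bullet> (A *\<^sub>v x) \<le> eigval A 1 * (x \<bullet> x)"
proof -
  obtain W where W: "x \<bullet> x = (\<Sum>i<m. ((W *\<^sub>v x) $ i)\<^sup>2)"
      "x \<bullet> (A *\<^sub>v x) = (\<Sum>i<m. eigval A (Suc i) * ((W *\<^sub>v x) $ i)\<^sup>2)"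
    using quadratic_form_diagonalization[OF A] x by metis
  show "eigval A m * (x \<bullet> x) \<le> x \<bullet> (A *\<^sub>v x)"
    unfolding W sum_distrib_left
    by (intro sum_mono mult_right_mono eigval_antimono[OF A]) auto
  show "x \<bullet> (A *\<^sub>v x) \<le> eigval A 1 * (x \<bullet> x)"
    unfolding W sum_distrib_left
    by (intro sum_mono mult_right_mono eigval_antimono[OF A]) auto
qed

text \<open>Only \<open>m - 1\<close> linear conditions are imposed, so the coefficient matrix can be padded with a zero
  row and is singular.\<close>

lemma common_kernel_vector:
  fixes V W :: "'a :: field mat"
  assumes V: "V \<in> carrier_mat m m" and W: "W \<in> carrier_mat m m" and k: "k < m"
  obtains x where "x \<in> carrier_vec m" "x \<noteq> 0\<^sub>v m"
    and "\<And>i. i < k \<Longrightarrow> (W *\<^sub>v x) $ i = 0" and "\<And>i. k < i \<Longrightarrow> i < m \<Longrightarrow> (V *\<^sub>v x) $ i = 0"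
proof -
  define M where "M = mat m m (\<lambda>(i, j).
    if i < k then W $$ (i, j) else if i = k then 0 else V $$ (i, j))"
  have M: "M \<in> carrier_mat m m" by (simp add: M_def)
  have "M\<^sup>T *\<^sub>v unit_vec m k = 0\<^sub>v m"
    using k by (intro eq_vecI) (auto simp: M_def)
  moreover have "unit_vec m k \<noteq> (0\<^sub>v m :: 'a vec)" using k by simp
  ultimately have "det M\<^sup>T = 0"
    using M by (subst det_0_iff_vec_prod_zero_field[of _ m]) (auto intro: unit_vec_carrier)
  then have "det M = 0" using M by (simp add: det_transpose)
  then obtain x where x: "x \<in> carrier_vec m" "x \<noteq> 0\<^sub>v m" "M *\<^sub>v x = 0\<^sub>v m"
    unfolding det_0_iff_vec_prod_zero_field[OF M] by auto
  have Mx: "row M i \<bullet> x = 0" if "i < m" for i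
    using arg_cong[OF x(3), of "\<lambda>y. y $ i"] M that by simp
  show thesis
  proof (rule that[OF x(1,2)])
    fix i assume i: "i < k"
    then have "row M i = row W i" using W k by (intro eq_vecI) (auto simp: M_def)
    then show "(W *\<^sub>v x) $ i = 0" using Mx[of i] W i k by simp
  next
    fix i assume i: "k < i" "i < m"
    then have "row M i = row V i" using V by (intro eq_vecI) (auto simp: M_def)
    then show "(V *\<^sub>v x) $ i = 0" using Mx[of i] V i by simp
  qed
qed

section \<open>Comparison of ordered eigenvalues and Weyl's inequalities\<close>

text \<open>The shift \<open>c\<close> lets one comparison serve both Weyl inequalities, with an
  extreme eigenvalue of the added matrix, up to sign, in its place.\<close>

lemma eigval_le_of_quadratic_form_le:
  fixes A B :: "real mat"
  assumes A: "A \<in> carrier_mat m m" "A\<^sup>T = A" and B: "B \<in> carrier_mat m m" "B\<^sup>T = B"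
    and j: "1 \<le> j" "j \<le> m"
    and le: "\<And>x. x \<in> carrier_vec m \<Longrightarrow> x \<bullet> (A *\<^sub>v x) \<le> x \<bullet> (B *\<^sub>v x) + c * (x \<bullet> x)"
  shows "eigval A j \<le> eigval B j + c"
proof -
  obtain V where V: "V \<in> carrier_mat m m"
    "\<And>x. x \<in> carrier_vec m \<Longrightarrow> x \<bullet> x = (\<Sum>i<m. ((V *\<^sub>v x) $ i)\<^sup>2)"
    "\<And>x. x \<in> carrier_vec m \<Longrightarrow>
      x \<bullet> (A *\<^sub>v x) = (\<Sum>i<m. eigval A (Suc i) * ((V *\<^sub>v x) $ i)\<^sup>2)"
    using quadratic_form_diagonalization[OF A] by blast
  obtain W where W: "W \<in> carrier_mat m m"
    "\<And>x. x \<in> carrier_vec m \<Longrightarrow> x \<bullet> x = (\<Sum>i<m. ((W *\<^sub>v x) $ i)\<^sup>2)"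
    "\<And>x. x \<in> carrier_vec m \<Longrightarrow>
      x \<bullet> (B *\<^sub>v x) = (\<Sum>i<m. eigval B (Suc i) * ((W *\<^sub>v x) $ i)\<^sup>2)"
    using quadratic_form_diagonalization[OF B] by blast
  \<comment> \<open>Coordinates count from 0, so \<open>j - 1\<close> is the one belonging to the
    \<open>j\<close>-th eigenvalue; no condition is imposed there.\<close>
  have jm: "j - 1 < m" using j by simp
  obtain x where x: "x \<in> carrier_vec m" "x \<noteq> 0\<^sub>v m"
    and Wx: "\<And>i. i < j - 1 \<Longrightarrow> (W *\<^sub>v x) $ i = 0"
    and Vx: "\<And>i. j - 1 < i \<Longrightarrow> i < m \<Longrightarrow> (V *\<^sub>v x) $ i = 0"
    using common_kernel_vector[OF V(1) W(1) jm] by blast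
  \<comment> \<open>Only coordinates \<open>i \<le> j - 1\<close> survive, and their weights are at
    least \<open>eigval A j\<close>.\<close>
  have "eigval A j * (x \<bullet> x) \<le> x \<bullet> (A *\<^sub>v x)"
    unfolding V(2,3)[OF x(1)] sum_distrib_left
  proof (rule sum_mono)
    fix i assume "i \<in> {..<m}"
    then show "eigval A j * ((V *\<^sub>v x) $ i)\<^sup>2 \<le> eigval A (Suc i) * ((V *\<^sub>v x) $ i)\<^sup>2"
      using Vx[of i] eigval_antimono[OF A, of "Suc i" j] j
      by (cases "j - 1 < i") (auto intro!: mult_right_mono)
  qed
  also have "\<dots> \<le> x \<bullet> (B *\<^sub>v x) + c * (x \<bullet> x)" using x(1) by (rule le)
  \<comment> \<open>Here only coordinates \<open>i \<ge> j - 1\<close> survive, with weights at most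
    \<open>eigval B j\<close>.\<close>
  also have "x \<bullet> (B *\<^sub>v x) \<le> eigval B j * (x \<bullet> x)"
    unfolding W(2,3)[OF x(1)] sum_distrib_left
  proof (rule sum_mono)
    fix i assume "i \<in> {..<m}"
    then show "eigval B (Suc i) * ((W *\<^sub>v x) $ i)\<^sup>2 \<le> eigval B j * ((W *\<^sub>v x) $ i)\<^sup>2"
      using Wx[of i] eigval_antimono[OF B, of j "Suc i"] j
      by (cases "i < j - 1") (auto intro!: mult_right_mono)
  qed
  finally have "eigval A j * (x \<bullet> x) \<le> (eigval B j + c) * (x \<bullet> x)"
    by (simp add: distrib_right)
  moreover have "0 < x \<bullet> x"
    using conjugate_square_greater_0_vec[OF x(1)] x(2) by simp
  ultimately show ?thesis by simp
qed

theorem weyl_inequalities: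
  fixes A B :: "real mat"
  assumes A: "A \<in> carrier_mat m m" "A\<^sup>T = A" and B: "B \<in> carrier_mat m m" "B\<^sup>T = B"
    and j: "1 \<le> j" "j \<le> m"
  shows "eigval A j + eigval B m \<le> eigval (A + B) j"
    and "eigval (A + B) j \<le> eigval A j + eigval B 1"
proof -
  have AB: "A + B \<in> carrier_mat m m" "(A + B)\<^sup>T = A + B"
    using A B by (auto simp: transpose_add[of _ m m])
  have split: "x \<bullet> ((A + B) *\<^sub>v x) = x \<bullet> (A *\<^sub>v x) + x \<bullet> (B *\<^sub>v x)" if "x \<in> carrier_vec m" for x
    using that A B
    by (simp add: add_mult_distrib_mat_vec[of _ m m] scalar_prod_add_distrib[of _ m])
  have m: "1 \<le> m" using j by simp
  note bounds = quadratic_form_bounds[OF B _ m]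
  \<comment> \<open>The form of \<open>A\<close> is that of \<open>A + B\<close> minus that of
    \<open>B\<close>, and the latter is at least \<open>eigval B m\<close> times the squared
    norm.\<close>
  have "eigval A j \<le> eigval (A + B) j + - eigval B m"
    using bounds(1) split by (intro eigval_le_of_quadratic_form_le[OF A AB j]) force
  then show "eigval A j + eigval B m \<le> eigval (A + B) j" by simp
  show "eigval (A + B) j \<le> eigval A j + eigval B 1"
    using bounds(2) split by (intro eigval_le_of_quadratic_form_le[OF AB A j]) force
qed

section \<open>Application to \<open>Q_mat\<close> and \<open>D_mat\<close>\<close>

lemma transpose_Q_mat: "(Q_mat n)\<^sup>T = Q_mat n"
  by (rule eq_matI) (auto simp: Q_mat_def rho_def gcd.commute mult.commute)

lemma transpose_D_mat: "(D_mat r)\<^sup>T = D_mat r"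
  by (rule eq_matI) (auto simp: D_mat_def mat_diag_def)

theorem theorem4p2p8:
  fixes n r j :: nat
  assumes "n \<ge> 2"
    and "r = card (prime_factors n)"
    and "1 \<le> j" and "j \<le> 2 ^ r"
  shows "eigval (Q_mat n - D_mat r) j + eigval (D_mat r) (2 ^ r) \<le> eigval (Q_mat n) j
    \<and> eigval (Q_mat n) j \<le> eigval (Q_mat n - D_mat r) j + eigval (D_mat r) 1"
proof -
  have Q: "Q_mat n \<in> carrier_mat (2 ^ r) (2 ^ r)" by (simp add: Q_mat_def assms(2))
  have D: "D_mat r \<in> carrier_mat (2 ^ r) (2 ^ r)" by (simp add: D_mat_def)
  have QD: "Q_mat n - D_mat r \<in> carrier_mat (2 ^ r) (2 ^ r)" using D by (intro carrier_matI) auto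
  have "(Q_mat n - D_mat r)\<^sup>T = Q_mat n - D_mat r"
    using transpose_minus[OF Q D] by (simp add: transpose_Q_mat transpose_D_mat)
  \<comment> \<open>This presents \<open>Q_mat n\<close> as the sum of two symmetric matrices to
    which Weyl's inequalities apply.\<close>
  moreover have "Q_mat n - D_mat r + D_mat r = Q_mat n"
    using Q D by (intro eq_matI) auto
  ultimately show ?thesis
    using weyl_inequalities[OF QD _ D transpose_D_mat assms(3,4)] by simp
qed

end
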